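(* Let $a,b,c,d\in\mathbb R$ and, for $\hat t\ge 0$, let $\mathcal A^{[\hat t]}$ be the $2$-dimensional real algebra with basis $e_1,e_2$ and multiplication $e_ie_j=\sum_{k=1}^2c_{ijk}^{[\hat t]}e_k$, where \[c_{111}^{[\hat t]}=a\cos\hat t-b\sin\hat t,\quad c_{112}^{[\hat t]}=b\cos\hat t+a\sin\hat t,\quad c_{121}^{[\hat t]}=(1-a)\cos\hat t+b\sin\hat t,\quad c_{122}^{[\hat t]}=-b\cos\hat t+(1-a)\sin\hat t,\] \[c_{211}^{[\hat t]}=c\cos\hat t-d\sin\hat t,\quad c_{212}^{[\hat t]}=d\cos\hat t+c\sin\hat t,\quad c_{221}^{[\hat t]}=-c\cos\hat t-(1-d)\sin\hat t,\quad c_{222}^{[\hat t]}=(1-d)\cos\hat t-c\sin\hat t.\] Then $\mathcal A^{[\hat t]}$ is commutative for all $\hat t\ge 0$ if and only if $a=1-c$ and $b=-d$; otherwise $\mathcal A^{[\hat t]}$ is non-commutative for all $\hat t\ge 0$. *)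

theory Defs
  imports "HOL-Analysis.Analysis"
begin

definition sc_mult :: "real ^ 'n ^ 'n ^ 'n \<Rightarrow> real ^ 'n \<Rightarrow> real ^ 'n \<Rightarrow> real ^ 'n" where
  "sc_mult C x y = (\<Sum>i\<in>UNIV. \<Sum>j\<in>UNIV. (x $ i * y $ j) *\<^sub>R (\<Sum>k\<in>UNIV. C $ i $ j $ k *\<^sub>R axis k 1))"

text \<open>The next two facts characterise the product: it is the bilinear map with
  \<open>e\<^sub>i e\<^sub>j = (\<Sum>k. c\<^sub>i\<^sub>j\<^sub>k e\<^sub>k)\<close> on the standard basis \<open>e\<^sub>k = axis k 1\<close>.\<close>

lemma bilinear_sc_mult: "bilinear (sc_mult C)"
  unfolding bilinear_def sc_mult_def
  by (auto intro!: linearI simp: algebra_simps sum.distrib scaleR_sum_right)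

lemma sc_mult_axis:
  "sc_mult C (axis i 1) (axis j 1) = (\<Sum>k\<in>UNIV. C $ i $ j $ k *\<^sub>R axis k 1)"
proof -
  have "(axis i (1::real) $ p * axis j (1::real) $ q) *\<^sub>R v = (if q = j then if p = i then v else 0 else 0)"
    for p q and v :: "real ^ 'a"
    by (simp add: axis_def)
  then show ?thesis
    by (simp add: sc_mult_def)
qed

definition commutative_mult :: "('v \<Rightarrow> 'v \<Rightarrow> 'v) \<Rightarrow> bool" where
  "commutative_mult m \<longleftrightarrow> (\<forall>x y. m x y = m y x)"

definition struct_consts :: "real \<Rightarrow> real \<Rightarrow> real \<Rightarrow> real \<Rightarrow> real \<Rightarrow> real ^ 2 ^ 2 ^ 2" where
  "struct_consts a b c d t = vector
     [vector [vector [a * cos t - b * sin t, b * cos t + a * sin t],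
              vector [(1 - a) * cos t + b * sin t, - b * cos t + (1 - a) * sin t]],
      vector [vector [c * cos t - d * sin t, d * cos t + c * sin t],
              vector [- c * cos t - (1 - d) * sin t, (1 - d) * cos t - c * sin t]]]"

lemma struct_consts_entries:
  "struct_consts a b c d t $ 1 $ 1 $ 1 = a * cos t - b * sin t"
  "struct_consts a b c d t $ 1 $ 1 $ 2 = b * cos t + a * sin t"
  "struct_consts a b c d t $ 1 $ 2 $ 1 = (1 - a) * cos t + b * sin t"
  "struct_consts a b c d t $ 1 $ 2 $ 2 = - b * cos t + (1 - a) * sin t"
  "struct_consts a b c d t $ 2 $ 1 $ 1 = c * cos t - d * sin t"
  "struct_consts a b c d t $ 2 $ 1 $ 2 = d * cos t + c * sin t"
  "struct_consts a b c d t $ 2 $ 2 $ 1 = - c * cos t - (1 - d) * sin t"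
  "struct_consts a b c d t $ 2 $ 2 $ 2 = (1 - d) * cos t - c * sin t"
  by (simp_all add: struct_consts_def)

definition chain_mult :: "real \<Rightarrow> real \<Rightarrow> real \<Rightarrow> real \<Rightarrow> real \<Rightarrow> real ^ 2 \<Rightarrow> real ^ 2 \<Rightarrow> real ^ 2" where
  "chain_mult a b c d t = sc_mult (struct_consts a b c d t)"

end

theory Submission
  imports Defs
begin

text \<open>A product given by structure constants commutes exactly when the constants are symmetric
  in the first two indices. In dimension two this leaves one condition, \<open>e\<^sub>1 e\<^sub>2 = e\<^sub>2 e\<^sub>1\<close>. For the
  chain at hand the coordinates of the commutator \<open>e\<^sub>1 e\<^sub>2 - e\<^sub>2 e\<^sub>1\<close> are
  \<open>p cos t + q sin t\<close> and \<open>p sin t - q cos t\<close> with \<open>p = 1 - a - c\<close> and \<open>q = b + d\<close>: time acts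
  on the vector \<open>(p, -q)\<close> by the rotation through the angle \<open>t\<close>. Rotations are injective, so
  the commutator vanishes at one time if and only if \<open>p = q = 0\<close>, that is, if and only if it
  vanishes at all times. Both parts of the theorem follow from this criterion at a single time.\<close>

lemma commutative_sc_mult_iff:
  fixes C :: "real ^ 'n ^ 'n ^ 'n"
  shows "commutative_mult (sc_mult C) \<longleftrightarrow> (\<forall>i j. C $ i $ j = C $ j $ i)"
proof
  assume "commutative_mult (sc_mult C)"
  then have "sc_mult C (axis i 1) (axis j 1) = sc_mult C (axis j 1) (axis i 1)" for i j
    by (simp add: commutative_mult_def)
  moreover have "sc_mult C (axis i 1) (axis j 1) = C $ i $ j" for i j
    using basis_expansion[of "C $ i $ j"] by (simp add: sc_mult_axis scalar_mult_eq_scaleR)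
  ultimately show "\<forall>i j. C $ i $ j = C $ j $ i"
    by simp
next
  assume sym: "\<forall>i j. C $ i $ j = C $ j $ i"
  show "commutative_mult (sc_mult C)"
    unfolding commutative_mult_def sc_mult_def
  proof (intro allI)
    fix x y :: "real ^ 'n"
    let ?P = "\<lambda>i j. \<Sum>k\<in>UNIV. C $ i $ j $ k *\<^sub>R axis k (1::real)"
    have "(\<Sum>i\<in>UNIV. \<Sum>j\<in>UNIV. (x $ i * y $ j) *\<^sub>R ?P i j) =
          (\<Sum>j\<in>UNIV. \<Sum>i\<in>UNIV. (x $ i * y $ j) *\<^sub>R ?P i j)"
      by (rule sum.swap)
    also have "\<dots> = (\<Sum>j\<in>UNIV. \<Sum>i\<in>UNIV. (y $ j * x $ i) *\<^sub>R ?P j i)"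
    proof (intro sum.cong refl)
      fix i j
      have "C $ i $ j = C $ j $ i"
        using sym by blast
      then show "(x $ i * y $ j) *\<^sub>R ?P i j = (y $ j * x $ i) *\<^sub>R ?P j i"
        by (simp only: mult.commute)
    qed
    finally show "(\<Sum>i\<in>UNIV. \<Sum>j\<in>UNIV. (x $ i * y $ j) *\<^sub>R ?P i j) =
        (\<Sum>j\<in>UNIV. \<Sum>i\<in>UNIV. (y $ j * x $ i) *\<^sub>R ?P j i)" .
  qed
qed

text \<open>The squared length \<open>p\<^sup>2 + q\<^sup>2\<close> is invariant under rotation.\<close>

lemma rotation_eq_0_iff:
  fixes p q t :: real
  shows "p * cos t + q * sin t = 0 \<and> p * sin t - q * cos t = 0 \<longleftrightarrow> p = 0 \<and> q = 0"
proof -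
  have "(p * x + q * y)\<^sup>2 + (p * y - q * x)\<^sup>2 = (p\<^sup>2 + q\<^sup>2) * (y\<^sup>2 + x\<^sup>2)" for x y :: real
    by (simp add: power2_eq_square algebra_simps)
  from this[of "cos t" "sin t"]
  have "(p * cos t + q * sin t)\<^sup>2 + (p * sin t - q * cos t)\<^sup>2 = p\<^sup>2 + q\<^sup>2"
    by simp
  then show ?thesis
    by (metis sum_power2_eq_zero_iff)
qed

lemma commutative_chain_mult_iff:
  "commutative_mult (chain_mult a b c d t) \<longleftrightarrow> a = 1 - c \<and> b = - d"
proof -
  let ?C = "struct_consts a b c d t"
  have "commutative_mult (chain_mult a b c d t) \<longleftrightarrow> ?C $ 1 $ 2 = ?C $ 2 $ 1"
    by (auto simp: chain_mult_def commutative_sc_mult_iff forall_2)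
  also have "\<dots> \<longleftrightarrow> (1 - a - c) * cos t + (b + d) * sin t = 0 \<and>
      (1 - a - c) * sin t - (b + d) * cos t = 0"
    by (auto simp: vec_eq_iff forall_2 struct_consts_entries algebra_simps)
  also have "\<dots> \<longleftrightarrow> a = 1 - c \<and> b = - d"
    unfolding rotation_eq_0_iff by auto
  finally show ?thesis .
qed

theorem proposition8:
  fixes a b c d :: real
  shows "((\<forall>t\<ge>0. commutative_mult (chain_mult a b c d t)) \<longleftrightarrow> a = 1 - c \<and> b = - d) \<and>
         (\<not> (a = 1 - c \<and> b = - d) \<longrightarrow> (\<forall>t\<ge>0. \<not> commutative_mult (chain_mult a b c d t)))"
  unfolding commutative_chain_mult_iff by auto

end
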